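(* Let $\mathcal{U}(\{0,1\})\subset\mathcal{W}_2$ be the Ulam set generated by the one-letter words $0$ and $1$. For every word $u \in \mathcal{W}_2$: $u\in\mathcal{U}(\{0,1\})$ if and only if $\overline{u}\in\mathcal{U}(\{0,1\})$; and $u \in \mathcal{U}(\{0, 1\})$ if and only if $\widehat{u} \in \mathcal{U}(\{0, 1\})$.
   Context: $\mathcal{W}_2$ is the set of finite nonempty binary strings (words on the alphabet $\{0,1\}$), with multiplication $*$ given by concatenation; the size of a word is its length. The Ulam set $\mathcal{U}(\{0,1\})\subset\mathcal{W}_2$ is built as follows: first put the one-letter words $0$ and $1$ into it; then repeatedly add a shortest word not already in the set that can be written in exactly one way as a concatenation $v*w$ of two distinct words $v\neq w$ already in the set (representations are ordered pairs $(v,w)$). Ties among words of the same length may be broken arbitrarily without affecting the resulting set. Equivalently, a word $u$ of length at least $2$ is in $\mathcal{U}(\{0,1\})$ iff there is exactly one ordered pair $(v,w)$ of distinct elements of $\mathcal{U}(\{0,1\})$ with $u=v*w$. The reverse $\overline{u}$ of $u$ is the word obtained by reversing the order of the letters of $u$. The complement $\widehat{u}$ of $u$ is the word obtained by changing all $0$'s to $1$'s and all $1$'s to $0$'s. *)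

theory Defs
  imports Main
begin

text \<open>The letters \<open>0\<close> and \<open>1\<close> are \<^term>\<open>False\<close> and \<^term>\<open>True\<close>; concatenation is \<open>@\<close>,
  the reverse of a word is \<^const>\<open>rev\<close>, its size is \<^const>\<open>length\<close>.\<close>

type_synonym word = "bool list"

definition W2 :: "word set" where
  "W2 = {u. u \<noteq> []}"

definition word_complement :: "word \<Rightarrow> word" where
  "word_complement u = map Not u"

definition reps :: "word set \<Rightarrow> word \<Rightarrow> (word \<times> word) set" where
  "reps A u = {(v, w). v \<in> A \<and> w \<in> A \<and> v \<noteq> w \<and> u = v @ w}"

definition candidates :: "word set \<Rightarrow> word set" where
  "candidates A = {u \<in> W2. u \<notin> A \<and> (\<exists>!p. p \<in> reps A u)}"

definition ulam_step :: "word set \<Rightarrow> word set \<Rightarrow> bool" where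
  "ulam_step A B \<longleftrightarrow>
     (\<exists>u\<in>candidates A. (\<forall>x\<in>candidates A. length u \<le> length x) \<and> B = insert u A)"

text \<open>A run records one possible way of breaking ties. A run can always be continued
  (lemma \<open>ulam_run_exists\<close>), so no provision is made for the construction to stop.\<close>

definition ulam_run :: "(nat \<Rightarrow> word set) \<Rightarrow> bool" where
  "ulam_run S \<longleftrightarrow> S 0 = {[False], [True]} \<and> (\<forall>n. ulam_step (S n) (S (Suc n)))"

text \<open>The description is proper: see \<open>ulam_set_well_defined\<close> below.\<close>

definition ulam_set :: "word set" where
  "ulam_set = (THE U. \<exists>S. ulam_run S \<and> U = (\<Union>n. S n))"

subsection \<open>Runs exist\<close>

definition zeros_one :: "nat \<Rightarrow> word" where
  "zeros_one m = replicate m False @ [True]"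

definition run_inv :: "word set \<Rightarrow> bool" where
  "run_inv A \<longleftrightarrow> finite A \<and> [] \<notin> A \<and> [False] \<in> A \<and> [True] \<in> A \<and>
     (\<forall>a. replicate a False \<in> A \<longrightarrow> a = 1)"

lemma reps_zeros_one:
  assumes A: "run_inv A" and m: "zeros_one m \<in> A"
  shows "reps A (zeros_one (Suc m)) = {([False], zeros_one m)}"
proof -
  have "v = [False] \<and> w = zeros_one m"
    if v: "v \<in> A" and "w \<in> A" and h: "zeros_one (Suc m) = v @ w" for v w
  proof -
    have "w \<noteq> []" "v \<noteq> []" using that A by (auto simp: run_inv_def)
    then have w: "w = butlast w @ [last w]" by simp
    have "replicate (Suc m) False @ [True] = (v @ butlast w) @ [last w]"
      using h w by (simp add: zeros_one_def)
    then have eq: "replicate (Suc m) False = v @ butlast w" and l: "last w = True"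
      by (metis append1_eq_conv)+
    have "v = take (length v) (replicate (Suc m) False)"
      by (subst eq) simp
    then have "v = replicate (min (length v) (Suc m)) False"
      by (simp only: take_replicate)
    then have "v = replicate (length v) False"
      by (metis length_replicate)
    then have "length v = 1" using A v unfolding run_inv_def by metis
    then show ?thesis using h by (cases v) (auto simp: zeros_one_def)
  qed
  moreover have "[False] \<in> A" "[False] \<noteq> zeros_one m"
    using A by (auto simp: run_inv_def zeros_one_def Cons_eq_append_conv)
  moreover have "zeros_one (Suc m) = [False] @ zeros_one m"
    by (simp add: zeros_one_def)
  ultimately show ?thesis using m unfolding reps_def by blast
qed

lemma candidates_nonempty:
  assumes A: "run_inv A"
  shows "candidates A \<noteq> {}"
proof -
  let ?M = "{m. zeros_one m \<in> A}"
  have inj: "inj zeros_one" by (auto simp: inj_def zeros_one_def)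
  have fin: "finite ?M"
    using A inj finite_vimageI[of A zeros_one] by (simp add: run_inv_def vimage_def)
  have "0 \<in> ?M" using A by (simp add: run_inv_def zeros_one_def)
  then have "Max ?M \<in> ?M" using fin Max_in by blast
  moreover have "Suc (Max ?M) \<notin> ?M" using fin Max_ge not_less_eq_eq by blast
  ultimately have "zeros_one (Suc (Max ?M)) \<in> candidates A"
    using reps_zeros_one[OF A, of "Max ?M"]
    by (auto simp: candidates_def W2_def zeros_one_def)
  then show ?thesis by blast
qed

lemma run_inv_step:
  assumes A: "run_inv A" and s: "ulam_step A B"
  shows "run_inv B"
proof -
  obtain u where u: "u \<in> candidates A" and B: "B = insert u A"
    using s by (auto simp: ulam_step_def)
  have "a = 1" if "u = replicate a False" for a
  proof -
    obtain v w where vw: "v \<in> A" "w \<in> A" "v \<noteq> w" "u = v @ w"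
      using u by (auto simp: candidates_def reps_def)
    have "set v \<union> set w = set (replicate a False)"
      using vw(4) that by (metis set_append)
    then have "set v \<union> set w \<subseteq> {False}"
      by (simp add: set_replicate_conv_if split: if_splits)
    then have v: "v = replicate (length v) False" and w: "w = replicate (length w) False"
      by (auto intro!: replicate_eqI)
    have one: "\<And>b. replicate b False \<in> A \<Longrightarrow> b = 1" using A by (simp add: run_inv_def)
    have "length v = 1" "length w = 1"
      using one[of "length v"] one[of "length w"] v w vw(1,2) by simp_all
    then have "v = w" using v w by simp
    then show ?thesis using vw by simp
  qed
  then have "\<forall>a. replicate a False \<in> B \<longrightarrow> a = 1"
    using A unfolding B run_inv_def by blast
  moreover have "u \<noteq> []" using u by (simp add: candidates_def W2_def)
  ultimately show ?thesis using A by (simp add: run_inv_def B)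
qed

lemma ulam_step_exists:
  assumes "run_inv A"
  shows "\<exists>B. ulam_step A B"
proof -
  obtain c where "c \<in> candidates A" using candidates_nonempty[OF assms] by blast
  then have "\<exists>u. u \<in> candidates A \<and> (\<forall>x. x \<in> candidates A \<longrightarrow> length u \<le> length x)"
    by (rule ex_has_least_nat)
  then show ?thesis unfolding ulam_step_def by blast
qed

lemma run_inv_0: "run_inv {[False], [True]}"
proof -
  have "a = 1" if "replicate a False = [b]" for a b
    using arg_cong[OF that, of length] by simp
  then show ?thesis by (auto simp: run_inv_def)
qed

lemma ulam_run_exists: "\<exists>S. ulam_run S"
proof -
  define S where "S = rec_nat {[False], [True]} (\<lambda>_ A. SOME B. ulam_step A B)"
  have S0: "S 0 = {[False], [True]}" and SS: "S (Suc n) = (SOME B. ulam_step (S n) B)" for n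
    by (simp_all add: S_def)
  have step: "ulam_step (S n) (S (Suc n))" if "run_inv (S n)" for n
    unfolding SS using ulam_step_exists[OF that] by (rule someI_ex)
  have "run_inv (S n)" for n
    by (induction n) (auto simp: S0 run_inv_0 intro: run_inv_step step)
  then show ?thesis using S0 step by (auto simp: ulam_run_def)
qed

subsection \<open>All runs have the same union\<close>

definition ulam_rec :: "word set \<Rightarrow> bool" where
  "ulam_rec U \<longleftrightarrow> [] \<notin> U \<and> [False] \<in> U \<and> [True] \<in> U \<and>
     (\<forall>u. length u \<ge> 2 \<longrightarrow> (u \<in> U \<longleftrightarrow> (\<exists>!p. p \<in> reps U u)))"

lemma reps_cong:
  assumes "[] \<notin> A" "[] \<notin> B" "\<And>x. length x < length u \<Longrightarrow> x \<in> A \<longleftrightarrow> x \<in> B"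
  shows "reps A u = reps B u"
proof -
  have "v \<in> A \<and> w \<in> A \<longleftrightarrow> v \<in> B \<and> w \<in> B" if "u = v @ w" for v w
    using assms that by (cases "v = [] \<or> w = []") auto
  then show ?thesis unfolding reps_def by blast
qed

lemma ulam_rec_unique:
  assumes U: "ulam_rec U" and V: "ulam_rec V"
  shows "U = V"
proof -
  have "u \<in> U \<longleftrightarrow> u \<in> V" for u
  proof (induction u rule: length_induct)
    case (1 u)
    show ?case
    proof (cases "length u \<ge> 2")
      case True
      have "reps U u = reps V u" using 1 U V by (intro reps_cong) (auto simp: ulam_rec_def)
      then show ?thesis using True U V by (simp add: ulam_rec_def)
    next
      case False
      then have "u = [] \<or> u = [False] \<or> u = [True]"
        by (cases u) (auto simp: Suc_le_eq numeral_2_eq_2)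
      then show ?thesis using U V by (auto simp: ulam_rec_def)
    qed
  qed
  then show ?thesis by blast
qed

lemma ulam_run_rec:
  assumes "ulam_run S"
  shows "ulam_rec (\<Union>n. S n)"
proof -
  define U where "U = (\<Union>n. S n)"
  have "\<forall>n. \<exists>u. u \<in> candidates (S n) \<and> (\<forall>x\<in>candidates (S n). length u \<le> length x)
            \<and> S (Suc n) = insert u (S n)"
    using assms unfolding ulam_run_def ulam_step_def Bex_def by (elim conjE)
  from choice[OF this] obtain a where
      "\<forall>n. a n \<in> candidates (S n) \<and> (\<forall>x\<in>candidates (S n). length (a n) \<le> length x)
            \<and> S (Suc n) = insert (a n) (S n)" ..
  then have a: "\<And>n. a n \<in> candidates (S n)"
      "\<And>n x. x \<in> candidates (S n) \<Longrightarrow> length (a n) \<le> length x"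
      "\<And>n. S (Suc n) = insert (a n) (S n)"
    by auto
  have S0: "S 0 = {[False], [True]}" using assms by (simp add: ulam_run_def)
  have ne: "[] \<notin> S n" for n
  proof (induction n)
    case (Suc n)
    have "a n \<noteq> []" using a(1)[of n] by (simp add: candidates_def W2_def)
    then show ?case using Suc by (simp add: a(3))
  qed (simp add: S0)
  have neU: "[] \<notin> U" using ne by (auto simp: U_def)
  have mono: "S m \<subseteq> S n" if "m \<le> n" for m n
    using lift_Suc_mono_le[of S] that a(3) by blast
  have len: "length (a n) \<le> length (a (Suc n))" for n
  proof (rule ccontr)
    assume less: "\<not> ?thesis"
    have "reps (S (Suc n)) (a (Suc n)) = reps (S n) (a (Suc n))"
      using less ne by (intro reps_cong) (auto simp: a(3))
    then have "a (Suc n) \<in> candidates (S n)"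
      using a(1)[of "Suc n"] by (auto simp: candidates_def a(3))
    then show False using a(2) less by blast
  qed
  have len_mono: "length (a m) \<le> length (a n)" if "m \<le> n" for m n
    using lift_Suc_mono_le[of "\<lambda>n. length (a n)"] len that by blast
  have mem: "x \<in> S 0 \<or> (\<exists>m<n. x = a m)" if "x \<in> S n" for x n
    using that by (induction n) (auto simp: a(3) less_Suc_eq)
  have U_early: "x \<in> S n" if "x \<in> U" "length x < length (a n)" for x n
  proof -
    obtain k where "x \<in> S k" using \<open>x \<in> U\<close> by (auto simp: U_def)
    then consider "x \<in> S 0" | m where "x = a m" using mem by blast
    then show ?thesis
    proof cases
      case 1 then show ?thesis using mono[of 0 n] by auto
    next
      case 2
      then have "m < n" using that(2) len_mono[of n m] by (cases "m < n") auto
      then show ?thesis using 2 a(3)[of m] mono[of "Suc m" n] by auto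
    qed
  qed
  have reps_eq: "reps U u = reps (S n) u" if "length u \<le> length (a n)" for u n
  proof (rule reps_cong)
    fix x :: word assume "length x < length u"
    then have "length x < length (a n)" using that by simp
    then show "x \<in> U \<longleftrightarrow> x \<in> S n" using U_early by (auto simp only: U_def)
  qed (use neU ne in blast)+
  have fresh: "a m \<noteq> a n" if "m < n" for m n
    using a(1)[of n] a(3)[of m] mono[of "Suc m" n] that by (auto simp: candidates_def)
  have inj: "inj a" using fresh by (metis injI linorder_neqE_nat)
  have unb: "\<exists>n. length (a n) > k" for k
  proof (rule ccontr)
    assume "\<not> ?thesis"
    then have "range a \<subseteq> {xs. set xs \<subseteq> UNIV \<and> length xs \<le> k}" by (auto simp: not_less)
    then have "finite (range a)" using finite_lists_length_le[of "UNIV :: bool set" k]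
      by (meson finite finite_subset)
    then show False using inj finite_imageD by blast
  qed
  have "u \<in> U \<longleftrightarrow> (\<exists>!p. p \<in> reps U u)" if u: "length u \<ge> 2" for u
  proof
    assume "u \<in> U"
    then obtain k where "u \<in> S k" by (auto simp: U_def)
    then obtain m where "u = a m" using mem[of u k] u by (auto simp: S0)
    then show "\<exists>!p. p \<in> reps U u"
      using a(1)[of m] reps_eq[of u m] by (simp add: candidates_def)
  next
    assume uniq: "\<exists>!p. p \<in> reps U u"
    obtain n where n: "length u < length (a n)" using unb by blast
    show "u \<in> U"
    proof (rule ccontr)
      assume "u \<notin> U"
      then have "u \<in> candidates (S n)"
        using uniq reps_eq[of u n] n u by (auto simp: candidates_def W2_def U_def)
      then show False using a(2) n by (meson not_less)
    qed
  qed
  moreover have "[False] \<in> U" "[True] \<in> U" using S0 unfolding U_def by blast+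
  ultimately show ?thesis using neU by (simp add: ulam_rec_def flip: U_def)
qed

theorem ulam_set_well_defined: "\<exists>!U. \<exists>S. ulam_run S \<and> U = (\<Union>n. S n)"
proof (rule ex_ex1I)
  show "\<exists>U S. ulam_run S \<and> U = (\<Union>n. S n)"
    using ulam_run_exists by simp
next
  fix U V
  assume "\<exists>S. ulam_run S \<and> U = (\<Union>n. S n)" "\<exists>S. ulam_run S \<and> V = (\<Union>n. S n)"
  then show "U = V" by (elim exE conjE) (rule ulam_rec_unique, simp_all add: ulam_run_rec)
qed

lemma ulam_run_Union:
  assumes "ulam_run S"
  shows "(\<Union>n. S n) = ulam_set"
  unfolding ulam_set_def
  by (rule the1_equality[OF ulam_set_well_defined, symmetric], rule exI[of _ S]) (simp add: assms)

lemma ulam_rec_ulam_set: "ulam_rec ulam_set"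
proof -
  obtain S where S: "ulam_run S" using ulam_run_exists by blast
  show ?thesis using ulam_run_rec[OF S] by (simp add: ulam_run_Union[OF S])
qed

end

theory Submission
  imports Defs
begin

text \<open>The recursive description \<^const>\<open>ulam_rec\<close> of the Ulam set mentions only three things: the
  length of a word, the set of the two letters, and the number of ways to split a word into two
  distinct factors. Reversal and complement respect all three: complement turns a splitting
  \<open>(v, w)\<close> of \<open>u\<close> into a splitting of the complement of \<open>u\<close> factor by factor, while reversal also
  swaps the two factors, which is harmless because the condition \<open>v \<noteq> w\<close> is symmetric. Hence the
  preimage of the Ulam set under either involution satisfies the same recursive description, and
  since a set of words is determined by that description (lemma \<open>ulam_rec_unique\<close>), this preimage
  is the Ulam set itself.\<close>

lemma ulam_rec_length_1:
  assumes "ulam_rec U" "length u = 1"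
  shows "u \<in> U"
proof -
  obtain b where "u = [b]" using assms(2) by (auto simp: length_Suc_conv)
  then show ?thesis using assms(1) by (cases b) (auto simp: ulam_rec_def)
qed

text \<open>The map \<open>g\<close> records what the symmetry \<open>f\<close> does to splittings. Because \<open>g\<close> is a bijection,
  the splittings of \<open>u\<close> over the preimage of \<open>U\<close> and those of \<open>f u\<close> over \<open>U\<close> are equally many, so
  one is unique exactly when the other is. Letters go to letters because \<open>f\<close> preserves length and
  the words of length one are exactly the generators.\<close>

lemma ulam_rec_vimage:
  assumes U: "ulam_rec U"
    and len: "\<And>u. length (f u) = length u"
    and g: "bij g"
    and reps: "\<And>p u. g p \<in> reps U (f u) \<longleftrightarrow> p \<in> reps (f -` U) u"
  shows "ulam_rec (f -` U)"
proof -
  have "(\<exists>!p. p \<in> reps (f -` U) u) \<longleftrightarrow> (\<exists>!q. q \<in> reps U (f u))" for u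
  proof -
    have "g ` (g -` reps U (f u)) = reps U (f u)"
      using bij_is_surj[OF g] by (rule surj_image_vimage_eq)
    moreover have "g -` reps U (f u) = reps (f -` U) u"
      using reps by blast
    ultimately have "card (reps U (f u)) = card (reps (f -` U) u)"
      using card_image[OF inj_on_subset[OF bij_is_inj[OF g] subset_UNIV]] by metis
    then show ?thesis
      by (simp only: is_singleton_altdef flip: is_singleton_iff_ex1)
  qed
  moreover have "f [] = []" using len[of "[]"] by simp
  moreover have "f [b] \<in> U" for b
    using ulam_rec_length_1[OF U] len[of "[b]"] by simp
  ultimately show ?thesis using U len by (simp add: ulam_rec_def)
qed

lemma ulam_rec_vimage_rev:
  assumes "ulam_rec U"
  shows "ulam_rec (rev -` U)"
proof (rule ulam_rec_vimage[OF assms, where g = "\<lambda>(v, w). (rev w, rev v)"])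
  show "bij (\<lambda>(v, w :: word). (rev w, rev v :: word))"
    by (rule involuntory_imp_bij) auto
next
  fix p and u :: word
  have "rev u = rev w @ rev v \<longleftrightarrow> u = v @ w" for v w
    by (simp only: rev_append[symmetric] rev_is_rev_conv)
  then show "(case p of (v, w) \<Rightarrow> (rev w, rev v)) \<in> reps U (rev u) \<longleftrightarrow> p \<in> reps (rev -` U) u"
    by (cases p) (auto simp: reps_def simp del: rev_append)
qed simp

lemma word_complement_involution: "word_complement (word_complement u) = u"
  by (simp add: word_complement_def comp_def)

lemma word_complement_eq_iff: "word_complement u = word_complement v \<longleftrightarrow> u = v"
  by (metis word_complement_involution)

lemma word_complement_append:
  "word_complement (v @ w) = word_complement v @ word_complement w"
  by (simp add: word_complement_def)

lemma ulam_rec_vimage_word_complement: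
  assumes "ulam_rec U"
  shows "ulam_rec (word_complement -` U)"
proof (rule ulam_rec_vimage[OF assms, where g = "map_prod word_complement word_complement"])
  show "bij (map_prod word_complement word_complement)"
    by (rule involuntory_imp_bij) (auto simp: word_complement_involution)
next
  fix p and u :: word
  show "map_prod word_complement word_complement p \<in> reps U (word_complement u) \<longleftrightarrow>
        p \<in> reps (word_complement -` U) u"
    by (cases p)
      (simp add: reps_def word_complement_eq_iff flip: word_complement_append)
qed (simp add: word_complement_def)

theorem theorem3p1:
  fixes u :: word
  assumes "u \<in> W2"
  shows "(u \<in> ulam_set \<longleftrightarrow> rev u \<in> ulam_set) \<and>
         (u \<in> ulam_set \<longleftrightarrow> word_complement u \<in> ulam_set)"
proof -
  have "rev -` ulam_set = ulam_set"
    by (intro ulam_rec_unique ulam_rec_vimage_rev ulam_rec_ulam_set)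
  moreover have "word_complement -` ulam_set = ulam_set"
    by (intro ulam_rec_unique ulam_rec_vimage_word_complement ulam_rec_ulam_set)
  ultimately show ?thesis by blast
qed

end
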